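(* Let $l$ be a good line in the parameter plane, and let $p_1,p_2\in l\cap[-1,1]^2$ be two distinct points. Then $p_1$ and $p_2$ are not bad points associated with each other. In particular, for $j=1,2$, the line through $p_j$ that is parallel to the projection onto the parameter plane of the intersection line of the tangent planes $T_{p_1}\mathcal S$ and $T_{p_2}\mathcal S$ is a good line.
   Context: Fix $D$ and a sufficiently small constant $\varepsilon_0>0$. $\mathcal S=\{(\xi,\eta,h(\xi,\eta)):(\xi,\eta)\in[-1,1]^2\}$ with $h$ a real polynomial $$h(\xi,\eta)=\xi\eta+a_{2,0}\xi^2+a_{0,2}\eta^2+\sum_{i=3}^D\sum_{j=0}^i a_{i-j,j}\xi^{i-j}\eta^j,\qquad |a_{2,0}|+|a_{0,2}|+100^D\sum_{i=3}^D\sum_{j=0}^i|a_{i-j,j}|\le\varepsilon_0 .$$ The parameter plane is the $(\xi,\eta)$-plane; $T_p\mathcal S$ is the tangent plane to $\mathcal S$ at the point over $p$. Bad lines. For a line $\eta=\tan\alpha\cdot\xi+a$ making angle less than $\pi/4$ with the $\xi$-axis, let $F_{\alpha,a}$ be translation by $(0,-a)$ followed by rotation through angle $-\alpha$ (so the line is sent to $\{\eta=0\}$). For a line $\xi=\tan\alpha\cdot\eta+a$ making angle less than $\pi/4$ with the $\eta$-axis, let $M_{\alpha,a}$ be translation by $(-a,0)$ followed by the rotation sending the direction of the line to $(0,1)$ (so the line is sent to $\{\xi=0\}$). A line is bad if either (i) it makes angle less than $\pi/4$ with the $\xi$-axis and $h\circ F_{\alpha,a}^{-1}(\xi,\eta)=\eta\,\tilde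 h(\xi,\eta)+L(\xi)$ with $\tilde h$ a polynomial and $L$ a linear (affine) function; or (ii) it makes angle less than $\pi/4$ with the $\eta$-axis and $h\circ M_{\alpha,a}^{-1}(\xi,\eta)=\xi\,\tilde h(\xi,\eta)+L(\eta)$ with $\tilde h$ a polynomial and $L$ linear (affine). Good lines. A line in the parameter plane is good if its angle with each of the coordinate axes is greater than $\varepsilon_0^{1/2}$. Bad points. For $\zeta_1\in[-1,1]^2$, a point $\zeta_2\in[-1,1]^2$ is a bad point associated with $\zeta_1$ if either (1) the normal vector to $\mathcal S$ at $\zeta_2$ coincides with that at $\zeta_1$; or (2) the tangent planes at $\zeta_1$ and $\zeta_2$ intersect in a line, and there is a bad line through $\zeta_2$ whose corresponding straight line on $\mathcal S$ is parallel to this intersection line.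
   Formalization: The literal last claim fails (h=ξη-ε₀ξ², chord slope tan√ε₀+ε₀): it is proved instead that the line through p_j has angle >√ε₀-Cε₀ with both axes, and is good whenever l has angles >√ε₀+Cε₀, with C fixed before ε₀. *)

theory Defs
  imports "HOL-Analysis.Analysis"
begin

text \<open>
  The parameter plane is \<^typ>\<open>real \<times> real\<close> and the ambient space is \<^typ>\<open>(real \<times> real) \<times> real\<close>,
  so that \<^const>\<open>fst\<close> is the projection of the ambient space onto the parameter plane.
\<close>

definition param_square :: "(real \<times> real) set" where
  "param_square = {-1..1} \<times> {-1..1}"

text \<open>The coefficient of \<open>\<xi>\<^sup>i \<eta>\<^sup>j\<close> is \<open>a i j\<close>; only the entries occurring below matter.\<close>

definition surf_poly :: "nat \<Rightarrow> (nat \<Rightarrow> nat \<Rightarrow> real) \<Rightarrow> real \<times> real \<Rightarrow> real" where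
  "surf_poly D a = (\<lambda>(\<xi>, \<eta>). \<xi> * \<eta> + a 2 0 * \<xi>^2 + a 0 2 * \<eta>^2
      + (\<Sum>i=3..D. \<Sum>j=0..i. a (i - j) j * \<xi>^(i - j) * \<eta>^j))"

definition small_coeffs :: "nat \<Rightarrow> real \<Rightarrow> (nat \<Rightarrow> nat \<Rightarrow> real) \<Rightarrow> bool" where
  "small_coeffs D \<epsilon> a \<longleftrightarrow>
     \<bar>a 2 0\<bar> + \<bar>a 0 2\<bar> + 100^D * (\<Sum>i=3..D. \<Sum>j=0..i. \<bar>a (i - j) j\<bar>) \<le> \<epsilon>"

definition tangent_plane :: "(real \<times> real \<Rightarrow> real) \<Rightarrow> real \<times> real \<Rightarrow> ((real \<times> real) \<times> real) set" where
  "tangent_plane h p = {(q, z). z = h p + frechet_derivative h (at p) (q - p)}"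

text \<open>The upward unit normal \<open>(-\<partial>\<^sub>\<xi>h, -\<partial>\<^sub>\<eta>h, 1)\<close>, normalised, at the point of the graph over \<open>p\<close>.\<close>

definition normal_vector :: "(real \<times> real \<Rightarrow> real) \<Rightarrow> real \<times> real \<Rightarrow> (real \<times> real) \<times> real" where
  "normal_vector h p =
     sgn ((- frechet_derivative h (at p) (1, 0), - frechet_derivative h (at p) (0, 1)), 1)"

definition line_along :: "'a::real_vector \<Rightarrow> 'a \<Rightarrow> 'a set" where
  "line_along p u = range (\<lambda>t. p + t *\<^sub>R u)"

definition is_line :: "'a::real_vector set \<Rightarrow> bool" where
  "is_line l \<longleftrightarrow> (\<exists>p u. u \<noteq> 0 \<and> l = line_along p u)"

text \<open>The angle in \<open>[0, \<pi>/2]\<close> between two lines with directions \<open>u\<close> and \<open>v\<close>.\<close>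

definition line_angle :: "'a::real_inner \<Rightarrow> 'a \<Rightarrow> real" where
  "line_angle u v = arccos (\<bar>u \<bullet> v\<bar> / (norm u * norm v))"

text \<open>
  The threshold is a separate parameter because the passage from the chord \<open>p\<^sub>1p\<^sub>2\<close> to the projected
  intersection line of the tangent planes can decrease the angle with an axis by an amount of
  order \<open>\<epsilon>\<close>. For instance, with \<open>h = \<xi>\<eta> - \<epsilon>\<xi>\<^sup>2\<close>, \<open>p\<^sub>1 = 0\<close> and \<open>p\<^sub>2\<close> on a line of slope \<open>tan (sqrt \<epsilon>) + \<epsilon>\<close>,
  the projected line has slope \<open>-(tan (sqrt \<epsilon>) - \<epsilon>)\<close>, so the chord is good and the other line is not.
\<close>

definition axes_angle_gt :: "real \<Rightarrow> (real \<times> real) set \<Rightarrow> bool" where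
  "axes_angle_gt \<theta> l \<longleftrightarrow> (\<exists>p u. u \<noteq> 0 \<and> l = line_along p u \<and>
     line_angle u (1, 0) > \<theta> \<and> line_angle u (0, 1) > \<theta>)"

definition good_line :: "real \<Rightarrow> (real \<times> real) set \<Rightarrow> bool" where
  "good_line \<epsilon> l \<longleftrightarrow> axes_angle_gt (sqrt \<epsilon>) l"

definition rotation :: "real \<Rightarrow> real \<times> real \<Rightarrow> real \<times> real" where
  "rotation \<theta> = (\<lambda>(x, y). (cos \<theta> * x - sin \<theta> * y, sin \<theta> * x + cos \<theta> * y))"

definition F_map :: "real \<Rightarrow> real \<Rightarrow> real \<times> real \<Rightarrow> real \<times> real" where
  "F_map \<alpha> a p = rotation (- \<alpha>) (p - (0, a))"

text \<open>The line \<open>\<xi> = tan \<alpha> \<cdot> \<eta> + a\<close> has direction \<open>(sin \<alpha>, cos \<alpha>)\<close>, which the rotation through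
  \<open>+\<alpha>\<close> sends to \<open>(0, 1)\<close>.\<close>

definition M_map :: "real \<Rightarrow> real \<Rightarrow> real \<times> real \<Rightarrow> real \<times> real" where
  "M_map \<alpha> a p = rotation \<alpha> (p - (a, 0))"

definition bad_line :: "(real \<times> real \<Rightarrow> real) \<Rightarrow> (real \<times> real) set \<Rightarrow> bool" where
  "bad_line h l \<longleftrightarrow>
     (\<exists>\<alpha> a. \<bar>\<alpha>\<bar> < pi / 4 \<and> l = {(\<xi>, \<eta>). \<eta> = tan \<alpha> * \<xi> + a} \<and>
        (\<exists>g b c. real_polynomial_function g \<and>
           (\<forall>\<xi> \<eta>. (h \<circ> inv (F_map \<alpha> a)) (\<xi>, \<eta>) = \<eta> * g (\<xi>, \<eta>) + (b * \<xi> + c)))) \<or>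
     (\<exists>\<alpha> a. \<bar>\<alpha>\<bar> < pi / 4 \<and> l = {(\<xi>, \<eta>). \<xi> = tan \<alpha> * \<eta> + a} \<and>
        (\<exists>g b c. real_polynomial_function g \<and>
           (\<forall>\<xi> \<eta>. (h \<circ> inv (M_map \<alpha> a)) (\<xi>, \<eta>) = \<xi> * g (\<xi>, \<eta>) + (b * \<eta> + c))))"

text \<open>On a bad line \<open>h\<close> is affine, so that its lift to the graph of \<open>h\<close> is a straight line.\<close>

definition graph_lift :: "(real \<times> real \<Rightarrow> real) \<Rightarrow> (real \<times> real) set \<Rightarrow> ((real \<times> real) \<times> real) set" where
  "graph_lift h l = (\<lambda>q. (q, h q)) ` l"

text \<open>\<open>bad_point h \<zeta>\<^sub>1 \<zeta>\<^sub>2\<close>: the point \<open>\<zeta>\<^sub>2\<close> is a bad point associated with \<open>\<zeta>\<^sub>1\<close>.\<close>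

definition bad_point :: "(real \<times> real \<Rightarrow> real) \<Rightarrow> real \<times> real \<Rightarrow> real \<times> real \<Rightarrow> bool" where
  "bad_point h \<zeta>\<^sub>1 \<zeta>\<^sub>2 \<longleftrightarrow> \<zeta>\<^sub>1 \<in> param_square \<and> \<zeta>\<^sub>2 \<in> param_square \<and>
     (normal_vector h \<zeta>\<^sub>2 = normal_vector h \<zeta>\<^sub>1 \<or>
      (is_line (tangent_plane h \<zeta>\<^sub>1 \<inter> tangent_plane h \<zeta>\<^sub>2) \<and>
       (\<exists>l. bad_line h l \<and> \<zeta>\<^sub>2 \<in> l \<and>
          affine_parallel (graph_lift h l) (tangent_plane h \<zeta>\<^sub>1 \<inter> tangent_plane h \<zeta>\<^sub>2))))"

end

theory Submission
  imports Defs
begin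

text \<open>
  Up to an error of relative size \<open>2\<epsilon>\<close>, the gradient of \<open>h\<close> is that of \<open>\<xi>\<eta>\<close>: if
  \<open>p\<close> and \<open>q\<close> lie in the square \<open>[-2, 2]\<^sup>2\<close> and \<open>q - p = (x, y)\<close>, then
  \<open>grad h q - grad h p\<close> is \<open>(y, x)\<close> plus a vector with entries at most \<open>2\<epsilon>(\<bar>x\<bar> + \<bar>y\<bar>)\<close>
  (\<open>saddle_like_surf_poly\<close>). Besides differentiability, only this property of \<open>h\<close> is used.

  Write \<open>(A, B)\<close> for the difference of the gradients at \<open>p\<close> and \<open>q\<close>. If \<open>(A, B) \<noteq> 0\<close>, the tangent
  planes at \<open>p\<close> and \<open>q\<close> meet in a line whose projection is orthogonal to \<open>(A, B)\<close>, so it has the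
  direction \<open>(B, -A)\<close>. As \<open>(B, -A)\<close> is close to \<open>(x, -y)\<close>, this projection makes nearly the same
  angles with the axes as the chord from \<open>p\<close> to \<open>q\<close>; the loss is at most \<open>20\<epsilon>\<close>
  (\<open>axis_clear_perp_grad_diff\<close>). This gives the assertions on the intersection line, and it shows that
  \<open>(A, B) \<noteq> 0\<close>, so that the two normals differ.

  On a bad line through \<open>q\<close> with direction \<open>u\<close> the function \<open>h\<close> is affine, so \<open>grad h \<bullet> u\<close> is constant
  along it. Comparing the gradients at \<open>q\<close> and \<open>q + u\<close> gives \<open>2u\<^sub>1u\<^sub>2 = O(\<epsilon>\<bar>u\<bar>\<^sup>2)\<close>: a bad line makes an
  angle \<open>O(\<epsilon>)\<close> with one of the axes (\<open>bad_line_direction\<close>). If its lift is parallel to the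
  intersection line, then \<open>u\<close> is a multiple of \<open>(B, -A)\<close>, whose angles with the axes exceed
  \<open>sqrt \<epsilon> - 20\<epsilon> \<ge> sqrt \<epsilon> / 2\<close>, a contradiction for small \<open>\<epsilon>\<close> (\<open>axis_clear_product_gt\<close>).
\<close>

section \<open>Gradients\<close>

text \<open>Meaningful where \<open>h\<close> is differentiable, see \<open>frechet_derivative_eq_grad\<close>.\<close>

definition grad :: "(real \<times> real \<Rightarrow> real) \<Rightarrow> real \<times> real \<Rightarrow> real \<times> real" where
  "grad h p = (frechet_derivative h (at p) (1, 0), frechet_derivative h (at p) (0, 1))"

lemma grad_eqI:
  assumes "(h has_derivative (\<lambda>v. g \<bullet> v)) (at p)"
  shows "grad h p = g"
  by (simp add: grad_def inner_prod_def flip: frechet_derivative_at[OF assms])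

lemma frechet_derivative_eq_grad:
  assumes "h differentiable at p"
  shows "frechet_derivative h (at p) v = grad h p \<bullet> v"
proof -
  interpret linear "frechet_derivative h (at p)"
    using assms by (rule linear_frechet_derivative)
  have "v = fst v *\<^sub>R (1, 0) + snd v *\<^sub>R (0, 1)" by (simp add: prod_eq_iff)
  then have "frechet_derivative h (at p) v
      = fst v *\<^sub>R frechet_derivative h (at p) (1, 0) + snd v *\<^sub>R frechet_derivative h (at p) (0, 1)"
    by (metis add scale)
  then show ?thesis by (simp add: grad_def inner_prod_def)
qed

section \<open>Small perturbations of the hyperbolic paraboloid\<close>

text \<open>A bad line may meet \<^const>\<open>param_square\<close> in a corner only. Points at distance at most \<open>1\<close> from
  \<^const>\<open>param_square\<close> along such a line are needed, and these lie in the following larger square.\<close>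

definition big_square :: "(real \<times> real) set" where
  "big_square = {-2..2} \<times> {-2..2}"

text \<open>The map \<open>grad h\<close> is Lipschitz close to \<open>(x, y) \<mapsto> (y, x)\<close>, the gradient map of the saddle \<open>\<xi>\<eta>\<close>.\<close>

definition saddle_like :: "real \<Rightarrow> (real \<times> real \<Rightarrow> real) \<Rightarrow> bool" where
  "saddle_like \<epsilon> h \<longleftrightarrow> (\<forall>p. h differentiable at p) \<and>
     (\<forall>p\<in>big_square. \<forall>q\<in>big_square.
        \<bar>fst (grad h q - grad h p) - snd (q - p)\<bar> \<le> 2 * \<epsilon> * (\<bar>fst (q - p)\<bar> + \<bar>snd (q - p)\<bar>) \<and>
        \<bar>snd (grad h q - grad h p) - fst (q - p)\<bar> \<le> 2 * \<epsilon> * (\<bar>fst (q - p)\<bar> + \<bar>snd (q - p)\<bar>))"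

text \<open>The gradient of \<open>\<xi>\<^sup>m \<eta>\<^sup>n\<close>; for \<open>m = 0\<close> the factor \<open>real m\<close> annihilates the term with the
  truncated exponent \<open>m - 1 = 0\<close>.\<close>

definition monomial_grad :: "nat \<Rightarrow> nat \<Rightarrow> real \<times> real \<Rightarrow> real \<times> real" where
  "monomial_grad m n = (\<lambda>(x, y). (real m * x^(m - 1) * y^n, real n * x^m * y^(n - 1)))"

lemma has_derivative_monomial:
  "((\<lambda>p. fst p ^ m * snd p ^ n) has_derivative (\<lambda>v. monomial_grad m n p \<bullet> v)) (at p)"
  by (auto intro!: derivative_eq_intros
      simp: monomial_grad_def fun_eq_iff inner_prod_def algebra_simps split: prod.splits)

lemma abs_power_diff_le:
  fixes x y :: real
  assumes "\<bar>x\<bar> \<le> 2" "\<bar>y\<bar> \<le> 2"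
  shows "\<bar>x^m - y^m\<bar> \<le> real m * 2^m * \<bar>x - y\<bar>"
proof (induction m)
  case (Suc m)
  have "x ^ Suc m - y ^ Suc m = x * (x^m - y^m) + (x - y) * y^m"
    by (simp add: algebra_simps)
  then have "\<bar>x ^ Suc m - y ^ Suc m\<bar> \<le> \<bar>x\<bar> * \<bar>x^m - y^m\<bar> + \<bar>x - y\<bar> * \<bar>y\<bar>^m"
    by (metis abs_mult abs_triangle_ineq power_abs)
  also have "\<dots> \<le> 2 * (real m * 2^m * \<bar>x - y\<bar>) + \<bar>x - y\<bar> * 2^m"
    by (intro add_mono mult_mono power_mono assms Suc) auto
  also have "\<dots> \<le> real (Suc m) * 2 ^ Suc m * \<bar>x - y\<bar>"
    by (simp add: algebra_simps)
  finally show ?case .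
qed simp

lemma abs_monomial_diff_le:
  fixes x y x' y' :: real
  assumes "\<bar>x\<bar> \<le> 2" "\<bar>y\<bar> \<le> 2" "\<bar>x'\<bar> \<le> 2" "\<bar>y'\<bar> \<le> 2"
  shows "\<bar>x'^m * y'^n - x^m * y^n\<bar> \<le> real (m + n) * 2^(m + n) * (\<bar>x' - x\<bar> + \<bar>y' - y\<bar>)"
proof -
  have "x'^m * y'^n - x^m * y^n = (x'^m - x^m) * y'^n + x^m * (y'^n - y^n)"
    by (simp add: algebra_simps)
  then have "\<bar>x'^m * y'^n - x^m * y^n\<bar> \<le> \<bar>x'^m - x^m\<bar> * \<bar>y'\<bar>^n + \<bar>x\<bar>^m * \<bar>y'^n - y^n\<bar>"
    by (metis abs_mult abs_triangle_ineq power_abs)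
  also have "\<dots> \<le> (real m * 2^m * \<bar>x' - x\<bar>) * 2^n + 2^m * (real n * 2^n * \<bar>y' - y\<bar>)"
    by (intro add_mono mult_mono power_mono abs_power_diff_le assms) auto
  also have "\<dots> = 2^(m + n) * (real m * \<bar>x' - x\<bar> + real n * \<bar>y' - y\<bar>)"
    by (simp add: algebra_simps power_add)
  also have "\<dots> \<le> 2^(m + n) * (real (m + n) * (\<bar>x' - x\<bar> + \<bar>y' - y\<bar>))"
    by (intro mult_left_mono) (auto simp: algebra_simps)
  finally show ?thesis by (simp add: algebra_simps)
qed

lemma square_times_two_power_le: "real i * (real i * 2^i) \<le> 100^i"
proof -
  have "real i * (real i * 2^i) \<le> 2^i * (2^i * 2^i)"
    by (intro mult_mono) (auto simp: less_imp_le)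
  also have "\<dots> = (8::real)^i" by (simp flip: power_mult_distrib)
  also have "\<dots> \<le> 100^i" by (intro power_mono) auto
  finally show ?thesis .
qed

text \<open>The weight \<open>100\<^sup>D\<close> in the smallness condition dominates the Lipschitz constants of the gradients
  of all monomials of degree at most \<open>D\<close>; hence no constant depends on \<open>D\<close>.\<close>

lemma monomial_grad_diff_le:
  assumes "p \<in> big_square" "q \<in> big_square" "m + n \<le> D"
  shows "\<bar>fst (monomial_grad m n q - monomial_grad m n p)\<bar>
           \<le> 100^D * (\<bar>fst (q - p)\<bar> + \<bar>snd (q - p)\<bar>)" (is "?L1 \<le> _ * ?N")
    and "\<bar>snd (monomial_grad m n q - monomial_grad m n p)\<bar>
           \<le> 100^D * (\<bar>fst (q - p)\<bar> + \<bar>snd (q - p)\<bar>)" (is "?L2 \<le> _")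
proof -
  obtain x y x' y' where pq: "p = (x, y)" "q = (x', y')" by (cases p, cases q)
  have bd: "\<bar>x\<bar> \<le> 2" "\<bar>y\<bar> \<le> 2" "\<bar>x'\<bar> \<le> 2" "\<bar>y'\<bar> \<le> 2"
    using assms by (auto simp: pq big_square_def abs_le_iff)
  have key: "real k * \<bar>x'^i * y'^j - x^i * y^j\<bar> \<le> 100^D * ?N"
    if "k \<le> m + n" "i + j \<le> m + n" for k i j
  proof -
    have "real k * \<bar>x'^i * y'^j - x^i * y^j\<bar> \<le> real (m + n) * (real (i + j) * 2^(i + j) * ?N)"
      using that abs_monomial_diff_le[OF bd, of i j] by (intro mult_mono) (auto simp: pq)
    also have "\<dots> \<le> real (m + n) * (real (m + n) * 2^(m + n) * ?N)"
      using that by (intro mult_left_mono mult_right_mono mult_mono power_increasing) (auto simp del: of_nat_add)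
    also have "\<dots> = (real (m + n) * (real (m + n) * 2^(m + n))) * ?N" by simp
    also have "\<dots> \<le> 100^(m + n) * ?N"
      by (intro mult_right_mono square_times_two_power_le) auto
    also have "\<dots> \<le> 100^D * ?N"
      using assms(3) by (intro mult_right_mono power_increasing) auto
    finally show ?thesis .
  qed
  have "?L1 = real m * \<bar>x'^(m - 1) * y'^n - x^(m - 1) * y^n\<bar>"
    by (simp add: pq monomial_grad_def mult.assoc abs_mult flip: right_diff_distrib)
  also have "\<dots> \<le> 100^D * ?N" by (rule key) auto
  finally show "?L1 \<le> 100^D * ?N" .
  have "?L2 = real n * \<bar>x'^m * y'^(n - 1) - x^m * y^(n - 1)\<bar>"
    by (simp add: pq monomial_grad_def mult.assoc abs_mult flip: right_diff_distrib)
  also have "\<dots> \<le> 100^D * ?N" by (rule key) auto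
  finally show "?L2 \<le> 100^D * ?N" .
qed

lemma has_derivative_surf_poly:
  "(surf_poly D a has_derivative (\<lambda>v. (monomial_grad 1 1 p + a 2 0 *\<^sub>R monomial_grad 2 0 p
      + a 0 2 *\<^sub>R monomial_grad 0 2 p
      + (\<Sum>i=3..D. \<Sum>j=0..i. a (i - j) j *\<^sub>R monomial_grad (i - j) j p)) \<bullet> v)) (at p)"
proof -
  let ?m = "\<lambda>m n p. fst p ^ m * snd p ^ n :: real"
  have eq: "surf_poly D a = (\<lambda>p. ?m 1 1 p + a 2 0 * ?m 2 0 p + a 0 2 * ?m 0 2 p
      + (\<Sum>i=3..D. \<Sum>j=0..i. a (i - j) j * ?m (i - j) j p))"
    by (auto simp: surf_poly_def fun_eq_iff mult.assoc)
  show ?thesis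
    unfolding eq inner_add_left inner_sum_left inner_scaleR_left
    by (intro has_derivative_add has_derivative_sum has_derivative_mult_right has_derivative_monomial)
qed

lemma saddle_like_surf_poly:
  assumes small: "small_coeffs D \<epsilon> a"
  shows "saddle_like \<epsilon> (surf_poly D a)"
proof -
  let ?r = "\<lambda>p. \<Sum>i=3..D. \<Sum>j=0..i. a (i - j) j *\<^sub>R monomial_grad (i - j) j p"
  have grad: "grad (surf_poly D a) p = monomial_grad 1 1 p + a 2 0 *\<^sub>R monomial_grad 2 0 p
      + a 0 2 *\<^sub>R monomial_grad 0 2 p + ?r p" for p
    by (intro grad_eqI has_derivative_surf_poly)
  have fst_bound: "\<bar>fst (grad (surf_poly D a) q - grad (surf_poly D a) p) - snd (q - p)\<bar>
        \<le> 2 * \<epsilon> * (\<bar>fst (q - p)\<bar> + \<bar>snd (q - p)\<bar>)" (is "?E1 \<le> _ * ?N")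
    and snd_bound: "\<bar>snd (grad (surf_poly D a) q - grad (surf_poly D a) p) - fst (q - p)\<bar>
        \<le> 2 * \<epsilon> * (\<bar>fst (q - p)\<bar> + \<bar>snd (q - p)\<bar>)" (is "?E2 \<le> _")
    if pq: "p \<in> big_square" "q \<in> big_square" for p q
  proof -
    let ?S = "\<Sum>i=3..D. \<Sum>j=0..i. \<bar>a (i - j) j\<bar>"
    have tail: "\<bar>\<Sum>i=3..D. \<Sum>j=0..i. a (i - j) j * f (i - j) j\<bar> \<le> ?S * (100^D * ?N)"
      if f: "\<And>m n. m + n \<le> D \<Longrightarrow> \<bar>f m n\<bar> \<le> 100^D * ?N" for f
    proof -
      have "\<bar>\<Sum>i=3..D. \<Sum>j=0..i. a (i - j) j * f (i - j) j\<bar>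
          \<le> (\<Sum>i=3..D. \<Sum>j=0..i. \<bar>a (i - j) j * f (i - j) j\<bar>)"
        by (intro order_trans[OF sum_abs] sum_mono order_refl)
      also have "\<dots> \<le> (\<Sum>i=3..D. \<Sum>j=0..i. \<bar>a (i - j) j\<bar> * (100^D * ?N))"
        unfolding abs_mult by (intro sum_mono mult_left_mono f) auto
      finally show ?thesis by (simp add: sum_distrib_right)
    qed
    have bound: "2 * (\<bar>a 2 0\<bar> + \<bar>a 0 2\<bar>) * ?N + ?S * (100^D * ?N) \<le> 2 * \<epsilon> * ?N"
    proof -
      have "0 \<le> 100^D * ?S" by (intro mult_nonneg_nonneg sum_nonneg) auto
      then have "2 * (\<bar>a 2 0\<bar> + \<bar>a 0 2\<bar>) + 100^D * ?S \<le> 2 * \<epsilon>"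
        using small by (simp add: small_coeffs_def)
      from mult_right_mono[OF this, of ?N] show ?thesis
        by (simp add: algebra_simps)
    qed
    have fst_r: "fst (?r q - ?r p)
        = (\<Sum>i=3..D. \<Sum>j=0..i. a (i - j) j * fst (monomial_grad (i - j) j q - monomial_grad (i - j) j p))"
      by (simp add: fst_sum right_diff_distrib sum_subtractf)
    have snd_r: "snd (?r q - ?r p)
        = (\<Sum>i=3..D. \<Sum>j=0..i. a (i - j) j * snd (monomial_grad (i - j) j q - monomial_grad (i - j) j p))"
      by (simp add: snd_sum right_diff_distrib sum_subtractf)
    have "fst (grad (surf_poly D a) q - grad (surf_poly D a) p) - snd (q - p)
        = 2 * (a 2 0 * fst (q - p)) + fst (?r q - ?r p)"
      unfolding grad by (cases p; cases q) (simp add: monomial_grad_def algebra_simps)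
    then have "?E1 \<le> 2 * (\<bar>a 2 0\<bar> * \<bar>fst (q - p)\<bar>) + \<bar>fst (?r q - ?r p)\<bar>"
      by (simp flip: abs_mult)
    also have "\<dots> \<le> 2 * ((\<bar>a 2 0\<bar> + \<bar>a 0 2\<bar>) * ?N) + ?S * (100^D * ?N)"
      unfolding fst_r by (intro add_mono mult_mono tail monomial_grad_diff_le pq) auto
    also have "\<dots> \<le> 2 * \<epsilon> * ?N" using bound by (simp only: mult.assoc)
    finally show "?E1 \<le> 2 * \<epsilon> * ?N" .
    have "snd (grad (surf_poly D a) q - grad (surf_poly D a) p) - fst (q - p)
        = 2 * (a 0 2 * snd (q - p)) + snd (?r q - ?r p)"
      unfolding grad by (cases p; cases q) (simp add: monomial_grad_def algebra_simps)
    then have "?E2 \<le> 2 * (\<bar>a 0 2\<bar> * \<bar>snd (q - p)\<bar>) + \<bar>snd (?r q - ?r p)\<bar>"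
      by (simp flip: abs_mult)
    also have "\<dots> \<le> 2 * ((\<bar>a 2 0\<bar> + \<bar>a 0 2\<bar>) * ?N) + ?S * (100^D * ?N)"
      unfolding snd_r by (intro add_mono mult_mono tail monomial_grad_diff_le pq) auto
    also have "\<dots> \<le> 2 * \<epsilon> * ?N" using bound by (simp only: mult.assoc)
    finally show "?E2 \<le> 2 * \<epsilon> * ?N" .
  qed
  have "surf_poly D a differentiable at p" for p
    using has_derivative_surf_poly unfolding differentiable_def by blast
  with fst_bound snd_bound show ?thesis unfolding saddle_like_def by blast
qed

section \<open>Angles with the coordinate axes\<close>

text \<open>For \<open>0 \<le> \<theta> < \<pi>/2\<close> this says that \<open>v\<close> makes angles greater than \<open>\<theta>\<close> with both axes, see
  \<open>line_angles_gt_iff_axis_clear\<close>. It is free of inverse trigonometric functions and of norms.\<close>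

definition axis_clear :: "real \<Rightarrow> real \<times> real \<Rightarrow> bool" where
  "axis_clear \<theta> v \<longleftrightarrow> \<bar>fst v\<bar> * sin \<theta> < \<bar>snd v\<bar> * cos \<theta> \<and> \<bar>snd v\<bar> * sin \<theta> < \<bar>fst v\<bar> * cos \<theta>"

lemma less_arccos_iff_cross:
  fixes x y :: real
  assumes nz: "x \<noteq> 0 \<or> y \<noteq> 0" and th: "0 \<le> \<theta>" "\<theta> < pi / 2"
  shows "\<theta> < arccos (\<bar>x\<bar> / sqrt (x\<^sup>2 + y\<^sup>2)) \<longleftrightarrow> \<bar>x\<bar> * sin \<theta> < \<bar>y\<bar> * cos \<theta>"
proof -
  let ?r = "sqrt (x\<^sup>2 + y\<^sup>2)"
  have r: "0 < ?r" using nz by (simp add: sum_power2_gt_zero_iff)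
  have c: "0 < cos \<theta>" using th by (simp add: cos_gt_zero_pi)
  have s: "0 \<le> sin \<theta>" using th by (simp add: sin_ge_zero)
  have le1: "\<bar>x\<bar> / ?r \<le> 1" using r by simp
  have "0 \<le> \<bar>x\<bar> / ?r" using r by simp
  then have ge1: "-1 \<le> \<bar>x\<bar> / ?r" by linarith
  have square: "u < v \<longleftrightarrow> u\<^sup>2 < v\<^sup>2" if "0 \<le> u" "0 \<le> v" for u v :: real
    using that power2_less_imp_less[of u v] power_strict_mono[of u v 2] by auto
  have "\<theta> < arccos (\<bar>x\<bar> / ?r) \<longleftrightarrow> arccos (cos \<theta>) < arccos (\<bar>x\<bar> / ?r)"
    using th by (simp add: arccos_cos)
  also have "\<dots> \<longleftrightarrow> \<bar>x\<bar> / ?r < cos \<theta>"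
    using le1 ge1 by (intro arccos_less_mono) auto
  also have "\<dots> \<longleftrightarrow> \<bar>x\<bar> < cos \<theta> * ?r" using r by (simp add: pos_divide_less_eq)
  also have "\<dots> \<longleftrightarrow> \<bar>x\<bar>\<^sup>2 < (cos \<theta> * ?r)\<^sup>2"
    using c r by (intro square) auto
  also have "\<dots> \<longleftrightarrow> (\<bar>x\<bar> * sin \<theta>)\<^sup>2 < (\<bar>y\<bar> * cos \<theta>)\<^sup>2"
    by (simp add: power_mult_distrib sin_squared_eq algebra_simps)
  also have "\<dots> \<longleftrightarrow> \<bar>x\<bar> * sin \<theta> < \<bar>y\<bar> * cos \<theta>"
    using c s by (intro square[symmetric]) auto
  finally show ?thesis .
qed

lemma line_angles_gt_iff_axis_clear:
  assumes "v \<noteq> 0" and "0 \<le> \<theta>" "\<theta> < pi / 2"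
  shows "line_angle v (1, 0) > \<theta> \<and> line_angle v (0, 1) > \<theta> \<longleftrightarrow> axis_clear \<theta> v"
proof -
  obtain x y where v: "v = (x, y)" by (cases v)
  have nz: "x \<noteq> 0 \<or> y \<noteq> 0" using assms(1) by (auto simp: v zero_prod_def)
  then have nz': "y \<noteq> 0 \<or> x \<noteq> 0" by blast
  show ?thesis
    using less_arccos_iff_cross[OF nz assms(2,3)] less_arccos_iff_cross[OF nz' assms(2,3)]
    by (simp add: v line_angle_def axis_clear_def norm_Pair add.commute)
qed

lemma axis_clear_scaleR [simp]:
  assumes "c \<noteq> 0"
  shows "axis_clear \<theta> (c *\<^sub>R v) \<longleftrightarrow> axis_clear \<theta> v"
proof -
  have "0 < \<bar>c\<bar>" using assms by simp
  then show ?thesis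
    by (simp only: axis_clear_def fst_scaleR snd_scaleR real_scaleR_def abs_mult mult.assoc
        mult_less_cancel_left_pos)
qed

lemma mem_line_alongI: "q - p = t *\<^sub>R u \<Longrightarrow> q \<in> line_along p u"
  unfolding line_along_def by (rule range_eqI[of _ _ t]) (simp add: algebra_simps)

lemma diff_in_line_along:
  assumes "p \<in> line_along s u" "q \<in> line_along s u"
  obtains c where "q - p = c *\<^sub>R u"
proof -
  from assms obtain t t' where "p = s + t *\<^sub>R u" "q = s + t' *\<^sub>R u"
    by (auto simp: line_along_def)
  then have "q - p = (t' - t) *\<^sub>R u" by (simp add: algebra_simps)
  then show thesis by (rule that)
qed

lemma axis_clear_chord:
  assumes l: "axes_angle_gt \<theta> l" and th: "0 \<le> \<theta>" "\<theta> < pi / 2"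
    and pq: "p \<in> l" "q \<in> l" "p \<noteq> q"
  shows "axis_clear \<theta> (q - p)"
proof -
  obtain s u where u: "u \<noteq> 0" "l = line_along s u" "axis_clear \<theta> u"
    using l line_angles_gt_iff_axis_clear[OF _ th] unfolding axes_angle_gt_def by blast
  obtain c where c: "q - p = c *\<^sub>R u"
    using diff_in_line_along pq(1,2) unfolding u(2) by blast
  with pq(3) have "c \<noteq> 0" by auto
  with u(3) show ?thesis by (simp add: c)
qed

lemma sin_ge_half: "x / 2 \<le> sin x" if "0 \<le> x" "x \<le> 1" for x :: real
proof -
  have "x ^ 3 \<le> x * 1"
    unfolding power3_eq_cube mult.assoc using that by (intro mult_left_mono mult_le_one) auto
  moreover have "\<bar>sin x - x\<bar> \<le> x ^ 3 / 6"
    using Maclaurin_sin_bound[of x 3] that by (simp add: eval_nat_numeral sin_coeff_def)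
  ultimately show ?thesis using that by linarith
qed

text \<open>Stability of the angle condition: with \<open>N = \<bar>x\<bar> + \<bar>y\<bar>\<close>, lowering \<open>\<theta>\<close> by \<open>\<delta> = 20\<epsilon>\<close> opens a gap of at
  least \<open>sin \<delta> * N / 2 \<ge> 5\<epsilon>N\<close> in the inequality, while the perturbation costs at most \<open>4\<epsilon>N\<close>.\<close>

lemma cross_perturb:
  fixes x y A B :: real
  assumes th: "0 \<le> \<theta> - \<delta>" "\<theta> < pi / 2" and \<delta>: "\<delta> = 20 * \<epsilon>" "0 < \<epsilon>" "\<delta> \<le> 1 / 2"
    and cross: "\<bar>x\<bar> * sin \<theta> < \<bar>y\<bar> * cos \<theta>"
    and A: "\<bar>A - y\<bar> \<le> 2 * \<epsilon> * (\<bar>x\<bar> + \<bar>y\<bar>)" and B: "\<bar>B - x\<bar> \<le> 2 * \<epsilon> * (\<bar>x\<bar> + \<bar>y\<bar>)"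
  shows "\<bar>B\<bar> * sin (\<theta> - \<delta>) < \<bar>A\<bar> * cos (\<theta> - \<delta>)"
proof -
  define N where "N = \<bar>x\<bar> + \<bar>y\<bar>"
  \<comment> \<open>\<open>(Q, P)\<close> is \<open>(\<bar>x\<bar>, \<bar>y\<bar>)\<close> rotated through \<open>-\<theta>\<close>.\<close>
  define P where "P = \<bar>y\<bar> * cos \<theta> - \<bar>x\<bar> * sin \<theta>"
  define Q where "Q = \<bar>y\<bar> * sin \<theta> + \<bar>x\<bar> * cos \<theta>"
  have c: "0 \<le> cos \<theta>" "0 \<le> sin \<theta>" using th \<delta> by (auto intro!: cos_ge_zero sin_ge_zero)
  have c': "0 \<le> cos (\<theta> - \<delta>)" "0 \<le> sin (\<theta> - \<delta>)"
    using th \<delta> by (auto intro!: cos_ge_zero sin_ge_zero)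
  have P: "0 < P" and Q: "0 \<le> Q" using cross c by (auto simp: P_def Q_def)
  have "x \<noteq> 0 \<or> y \<noteq> 0" using cross by auto
  then have N: "0 < N" unfolding N_def by linarith
  have s: "10 * \<epsilon> \<le> sin \<delta>" using sin_ge_half[of \<delta>] \<delta> by simp
  have sc: "sin \<delta> \<le> cos \<delta>"
  proof -
    have "sin \<delta> \<le> sin (pi / 4)"
      using \<delta> pi_gt3 by (intro sin_monotone_2pi_le) auto
    also have "\<dots> = cos (pi / 4)" by (simp add: sin_45 cos_45)
    also have "\<dots> \<le> cos \<delta>"
      using \<delta> pi_gt3 by (intro cos_monotone_0_pi_le) auto
    finally show ?thesis .
  qed
  have "(Y * c - X * s)\<^sup>2 + (Y * s + X * c)\<^sup>2 = (X\<^sup>2 + Y\<^sup>2) * (s\<^sup>2 + c\<^sup>2)" for X Y c s :: real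
    by (simp add: power2_eq_square algebra_simps)
  from this[of "\<bar>y\<bar>" "cos \<theta>" "\<bar>x\<bar>" "sin \<theta>"] have PQ: "P\<^sup>2 + Q\<^sup>2 = x\<^sup>2 + y\<^sup>2"
    by (simp add: P_def Q_def)
  have "N\<^sup>2 \<le> 2 * (x\<^sup>2 + y\<^sup>2)"
    using zero_le_power2[of "\<bar>x\<bar> - \<bar>y\<bar>"] unfolding N_def power2_diff power2_sum by simp
  also have "\<dots> \<le> (2 * (P + Q))\<^sup>2"
    unfolding PQ[symmetric] power2_sum power_mult_distrib
    using P Q mult_nonneg_nonneg[of P Q] by simp
  finally have NPQ: "N \<le> 2 * (P + Q)"
    by (rule power2_le_imp_le) (use P Q in simp)
  have "Y * (c * d + s * e) - X * (s * d - c * e) = d * (Y * c - X * s) + e * (Y * s + X * c)"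
    for X Y c d s e :: real
    by (simp add: algebra_simps)
  then have "\<bar>y\<bar> * cos (\<theta> - \<delta>) - \<bar>x\<bar> * sin (\<theta> - \<delta>) = cos \<delta> * P + sin \<delta> * Q"
    unfolding P_def Q_def cos_diff sin_diff by blast
  also have "\<dots> \<ge> sin \<delta> * (P + Q)"
    using mult_right_mono[OF sc, of P] P by (simp add: algebra_simps)
  also have "sin \<delta> * (P + Q) \<ge> 10 * \<epsilon> * (N / 2)"
    using s NPQ P Q N \<delta> by (intro mult_mono) auto
  finally have lower: "5 * (\<epsilon> * N) \<le> \<bar>y\<bar> * cos (\<theta> - \<delta>) - \<bar>x\<bar> * sin (\<theta> - \<delta>)"
    by (simp add: mult.commute)
  have "\<bar>B\<bar> * sin (\<theta> - \<delta>) \<le> (\<bar>x\<bar> + 2 * (\<epsilon> * N)) * sin (\<theta> - \<delta>)"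
    using B by (intro mult_right_mono c') (auto simp: N_def)
  also have "\<dots> \<le> \<bar>x\<bar> * sin (\<theta> - \<delta>) + 2 * (\<epsilon> * N)"
    using N \<delta> by (simp add: distrib_right mult_left_le)
  finally have B': "\<bar>B\<bar> * sin (\<theta> - \<delta>) \<le> \<bar>x\<bar> * sin (\<theta> - \<delta>) + 2 * (\<epsilon> * N)" .
  have "\<bar>y\<bar> * cos (\<theta> - \<delta>) \<le> (\<bar>A\<bar> + 2 * (\<epsilon> * N)) * cos (\<theta> - \<delta>)"
    using A by (intro mult_right_mono c') (auto simp: N_def)
  also have "\<dots> \<le> \<bar>A\<bar> * cos (\<theta> - \<delta>) + 2 * (\<epsilon> * N)"
    using N \<delta> by (simp add: distrib_right mult_left_le)
  finally have A': "\<bar>y\<bar> * cos (\<theta> - \<delta>) \<le> \<bar>A\<bar> * cos (\<theta> - \<delta>) + 2 * (\<epsilon> * N)" .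
  have "0 < \<epsilon> * N" using N \<delta> by simp
  with lower A' B' show ?thesis by linarith
qed

section \<open>Intersection of two tangent planes\<close>

text \<open>The rotation of \<open>w\<close> through \<open>-\<pi>/2\<close>.\<close>

definition perp :: "real \<times> real \<Rightarrow> real \<times> real" where
  "perp w = (snd w, - fst w)"

lemma perp_eq_0_iff [simp]: "perp w = 0 \<longleftrightarrow> w = 0"
  by (auto simp: perp_def prod_eq_iff)

lemma param_square_subset: "param_square \<subseteq> big_square"
  by (auto simp: param_square_def big_square_def)

text \<open>The projected intersection line makes almost the same angles with the axes as the chord.\<close>

lemma axis_clear_perp_grad_diff:
  assumes h: "saddle_like \<epsilon> h" and \<epsilon>: "0 < \<epsilon>" "20 * \<epsilon> \<le> 1 / 2"
    and th: "20 * \<epsilon> \<le> \<theta>" "\<theta> < pi / 2"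
    and pq: "p \<in> big_square" "q \<in> big_square" and clear: "axis_clear \<theta> (q - p)"
  shows "axis_clear (\<theta> - 20 * \<epsilon>) (perp (grad h q - grad h p))"
proof -
  let ?w = "grad h q - grad h p"
  let ?N = "\<bar>fst (q - p)\<bar> + \<bar>snd (q - p)\<bar>"
  have A: "\<bar>fst ?w - snd (q - p)\<bar> \<le> 2 * \<epsilon> * ?N" and B: "\<bar>snd ?w - fst (q - p)\<bar> \<le> 2 * \<epsilon> * ?N"
    using h pq unfolding saddle_like_def by blast+
  have th': "0 \<le> \<theta> - 20 * \<epsilon>" using th by simp
  have "\<bar>snd ?w\<bar> * sin (\<theta> - 20 * \<epsilon>) < \<bar>fst ?w\<bar> * cos (\<theta> - 20 * \<epsilon>)"
    using clear by (intro cross_perturb[OF th' th(2) refl \<epsilon> _ A B]) (simp add: axis_clear_def)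
  moreover have "\<bar>fst ?w\<bar> * sin (\<theta> - 20 * \<epsilon>) < \<bar>snd ?w\<bar> * cos (\<theta> - 20 * \<epsilon>)"
    using clear
    by (intro cross_perturb[OF th' th(2) refl \<epsilon> _ B[unfolded add.commute[of "\<bar>fst _\<bar>"]]
          A[unfolded add.commute[of "\<bar>fst _\<bar>"]]]) (simp add: axis_clear_def)
  ultimately show ?thesis
    by (simp only: axis_clear_def perp_def fst_conv snd_conv abs_minus_cancel)
qed

lemma axis_clear_nonzero: "axis_clear \<theta> v \<Longrightarrow> v \<noteq> 0"
  by (auto simp: axis_clear_def)

text \<open>Two non-parallel planes over the parameter plane meet in a line, whose projection is orthogonal to
  the difference of the gradients.\<close>

lemma plane_inter_plane:
  fixes G G' :: "real \<times> real"
  assumes w: "G' - G \<noteq> 0"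
  obtains s where "{(q, z). z = k + G \<bullet> q} \<inter> {(q, z). z = k' + G' \<bullet> q}
      = line_along s (perp (G' - G), G \<bullet> perp (G' - G))"
proof -
  define w where "w = G' - G"
  define r where "r = w \<bullet> w"
  have r: "r \<noteq> 0" using assms by (simp add: r_def w_def)
  \<comment> \<open>the point nearest to the origin on the projection \<open>w \<bullet> q = k - k'\<close> of the intersection\<close>
  define q0 where "q0 = ((k - k') / r) *\<^sub>R w"
  have q0: "w \<bullet> q0 = k - k'" using r by (simp add: q0_def flip: r_def)
  have perp: "w \<bullet> perp w = 0" by (simp add: perp_def inner_prod_def)
  have decomp: "v = ((v \<bullet> perp w) / r) *\<^sub>R perp w" if "w \<bullet> v = 0" for v
  proof -
    obtain A B x y where [simp]: "w = (A, B)" "v = (x, y)" by (cases w, cases v)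
    have o: "A * x = - (B * y)" using that by (simp add: inner_prod_def)
    have r': "r = A * A + B * B" by (simp add: r_def inner_prod_def)
    have "x * r = (x * B - y * A) * B" using o r' by algebra
    moreover have "y * r = - ((x * B - y * A) * A)" using o r' by algebra
    ultimately show ?thesis using r by (simp add: perp_def inner_prod_def field_simps)
  qed
  have iff: "k + G \<bullet> q = k' + G' \<bullet> q \<longleftrightarrow> w \<bullet> (q - q0) = 0" for q
    using q0 by (simp add: w_def inner_diff_left inner_diff_right) linarith
  have "{(q, z). z = k + G \<bullet> q} \<inter> {(q, z). z = k' + G' \<bullet> q}
      = line_along (q0, k + G \<bullet> q0) (perp w, G \<bullet> perp w)" (is "?L = ?R")
  proof (intro set_eqI iffI)
    fix e assume "e \<in> ?L"
    then obtain q where q: "e = (q, k + G \<bullet> q)" "w \<bullet> (q - q0) = 0"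
      using iff by auto
    from decomp[OF q(2)] obtain t where t: "q - q0 = t *\<^sub>R perp w" by blast
    then have "q = q0 + t *\<^sub>R perp w" by (simp add: algebra_simps)
    then show "e \<in> ?R" unfolding q(1) line_along_def
      by (intro range_eqI[of _ _ t]) (simp add: inner_add_right)
  next
    fix e assume "e \<in> ?R"
    then obtain t where t: "e = (q0 + t *\<^sub>R perp w, k + G \<bullet> (q0 + t *\<^sub>R perp w))"
      by (auto simp: line_along_def inner_add_right algebra_simps)
    show "e \<in> ?L" using iff[of "q0 + t *\<^sub>R perp w"] by (simp add: t perp)
  qed
  then show thesis unfolding w_def by (rule that)
qed

lemma tangent_plane_eq:
  assumes "h differentiable at p"
  shows "tangent_plane h p = {(q, z). z = (h p - grad h p \<bullet> p) + grad h p \<bullet> q}"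
proof -
  have "h p + frechet_derivative h (at p) (q - p) = (h p - grad h p \<bullet> p) + grad h p \<bullet> q" for q
    by (simp add: frechet_derivative_eq_grad[OF assms] inner_diff_right)
  then show ?thesis by (simp only: tangent_plane_def)
qed

lemma fst_line_along: "fst ` line_along s u = line_along (fst s) (fst u)"
  by (simp add: line_along_def image_image)

lemma tangent_planes_inter:
  assumes "h differentiable at p" "h differentiable at q" "grad h q - grad h p \<noteq> 0"
  obtains s where "is_line (tangent_plane h p \<inter> tangent_plane h q)"
    "fst ` (tangent_plane h p \<inter> tangent_plane h q) = line_along s (perp (grad h q - grad h p))"
proof -
  obtain s where s: "tangent_plane h p \<inter> tangent_plane h q
      = line_along s (perp (grad h q - grad h p), grad h p \<bullet> perp (grad h q - grad h p))"
    unfolding tangent_plane_eq[OF assms(1)] tangent_plane_eq[OF assms(2)]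
    using plane_inter_plane[OF assms(3)] by blast
  show thesis
  proof
    have "(perp (grad h q - grad h p), grad h p \<bullet> perp (grad h q - grad h p)) \<noteq> 0"
      using assms(3) by (metis fst_conv fst_zero perp_eq_0_iff)
    then show "is_line (tangent_plane h p \<inter> tangent_plane h q)"
      unfolding s is_line_def by blast
    show "fst ` (tangent_plane h p \<inter> tangent_plane h q)
        = line_along (fst s) (perp (grad h q - grad h p))"
      by (simp add: s fst_line_along)
  qed
qed

lemma affine_parallel_line_along:
  assumes "affine_parallel m (line_along s u)"
  obtains s' where "m = line_along s' u"
proof -
  from assms obtain b where b: "line_along s u = (\<lambda>x. b + x) ` m"
    by (auto simp: affine_parallel_def)
  have "m = (\<lambda>x. - b + x) ` line_along s u" by (simp add: b image_image)
  also have "\<dots> = line_along (s - b) u"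
    by (simp add: line_along_def image_image algebra_simps)
  finally show thesis by (rule that)
qed

section \<open>Bad lines\<close>

lemma rotation_inverse: "rotation (- \<theta>) (rotation \<theta> v) = v"
proof -
  obtain x y where v: "v = (x, y)" by (cases v)
  have "cos \<theta> * (cos \<theta> * x - sin \<theta> * y) + sin \<theta> * (sin \<theta> * x + cos \<theta> * y)
      = x * ((sin \<theta>)\<^sup>2 + (cos \<theta>)\<^sup>2)"
    by algebra
  moreover have "cos \<theta> * (sin \<theta> * x + cos \<theta> * y) - sin \<theta> * (cos \<theta> * x - sin \<theta> * y)
      = y * ((sin \<theta>)\<^sup>2 + (cos \<theta>)\<^sup>2)"
    by algebra
  ultimately show ?thesis by (simp add: v rotation_def)
qed

lemma inj_rotation: "inj (rotation \<theta>)"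
  by (rule inj_on_inverseI) (rule rotation_inverse)

text \<open>Evaluating the defining identity of a bad line on the image \<open>\<eta> = 0\<close> (or \<open>\<xi> = 0\<close>) of the line
  removes the polynomial cofactor.\<close>

lemma bad_line_affine_on:
  assumes "bad_line h l"
  obtains s u b c where "l = line_along s u" "u \<noteq> 0" "\<bar>fst u\<bar> \<le> 1" "\<bar>snd u\<bar> \<le> 1"
    "\<And>t. h (s + t *\<^sub>R u) = b * t + c"
proof -
  have inv_F: "inv (F_map \<alpha> a) (t, 0) = (0, a) + t *\<^sub>R (cos \<alpha>, sin \<alpha>)" for \<alpha> a t
  proof (rule inv_f_eq)
    show "inj (F_map \<alpha> a)"
      by (intro injI) (auto simp: F_map_def dest!: injD[OF inj_rotation])
    have "(0, a) + t *\<^sub>R (cos \<alpha>, sin \<alpha>) - (0, a) = rotation \<alpha> (t, 0)"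
      by (simp add: rotation_def)
    then show "F_map \<alpha> a ((0, a) + t *\<^sub>R (cos \<alpha>, sin \<alpha>)) = (t, 0)"
      unfolding F_map_def by (simp only: rotation_inverse)
  qed
  have inv_M: "inv (M_map \<alpha> a) (0, t) = (a, 0) + t *\<^sub>R (sin \<alpha>, cos \<alpha>)" for \<alpha> a t
  proof (rule inv_f_eq)
    show "inj (M_map \<alpha> a)"
      by (intro injI) (auto simp: M_map_def dest!: injD[OF inj_rotation])
    have "(a, 0) + t *\<^sub>R (sin \<alpha>, cos \<alpha>) - (a, 0) = rotation (- \<alpha>) (0, t)"
      by (simp add: rotation_def)
    then show "M_map \<alpha> a ((a, 0) + t *\<^sub>R (sin \<alpha>, cos \<alpha>)) = (0, t)"
      unfolding M_map_def using rotation_inverse[of "- \<alpha>" "(0, t)"] by simp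
  qed
  from assms consider
    (F) \<alpha> a g b c where "\<bar>\<alpha>\<bar> < pi / 4" "l = {(\<xi>, \<eta>). \<eta> = tan \<alpha> * \<xi> + a}"
      "\<And>\<xi> \<eta>. h (inv (F_map \<alpha> a) (\<xi>, \<eta>)) = \<eta> * g (\<xi>, \<eta>) + (b * \<xi> + c)"
  | (M) \<alpha> a g b c where "\<bar>\<alpha>\<bar> < pi / 4" "l = {(\<xi>, \<eta>). \<xi> = tan \<alpha> * \<eta> + a}"
      "\<And>\<xi> \<eta>. h (inv (M_map \<alpha> a) (\<xi>, \<eta>)) = \<xi> * g (\<xi>, \<eta>) + (b * \<eta> + c)"
    unfolding bad_line_def comp_def by metis
  then show thesis
  proof cases
    case F
    have c: "cos \<alpha> > 0" using F(1) by (intro cos_gt_zero_pi) auto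
    have "l = line_along (0, a) (cos \<alpha>, sin \<alpha>)"
    proof (intro set_eqI iffI)
      fix e assume "e \<in> l"
      then have "e - (0, a) = (fst e / cos \<alpha>) *\<^sub>R (cos \<alpha>, sin \<alpha>)"
        using c by (auto simp: F(2) tan_def)
      then show "e \<in> line_along (0, a) (cos \<alpha>, sin \<alpha>)" by (rule mem_line_alongI)
    next
      fix e assume "e \<in> line_along (0, a) (cos \<alpha>, sin \<alpha>)"
      then show "e \<in> l" using c by (auto simp: F(2) line_along_def tan_def)
    qed
    moreover have "(cos \<alpha>, sin \<alpha>) \<noteq> 0" using c by (simp add: zero_prod_def)
    moreover have "h ((0, a) + t *\<^sub>R (cos \<alpha>, sin \<alpha>)) = b * t + c" for t
      using F(3)[of t 0] by (simp add: inv_F)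
    ultimately show thesis by (intro that) auto
  next
    case M
    have c: "cos \<alpha> > 0" using M(1) by (intro cos_gt_zero_pi) auto
    have "l = line_along (a, 0) (sin \<alpha>, cos \<alpha>)"
    proof (intro set_eqI iffI)
      fix e assume "e \<in> l"
      then have "e - (a, 0) = (snd e / cos \<alpha>) *\<^sub>R (sin \<alpha>, cos \<alpha>)"
        using c by (auto simp: M(2) tan_def)
      then show "e \<in> line_along (a, 0) (sin \<alpha>, cos \<alpha>)" by (rule mem_line_alongI)
    next
      fix e assume "e \<in> line_along (a, 0) (sin \<alpha>, cos \<alpha>)"
      then show "e \<in> l" using c by (auto simp: M(2) line_along_def tan_def)
    qed
    moreover have "(sin \<alpha>, cos \<alpha>) \<noteq> 0" using c by (simp add: zero_prod_def)
    moreover have "h ((a, 0) + t *\<^sub>R (sin \<alpha>, cos \<alpha>)) = b * t + c" for t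
      using M(3)[of 0 t] by (simp add: inv_M)
    ultimately show thesis by (intro that) auto
  qed
qed

lemma grad_along_affine_line:
  assumes "\<And>p. h differentiable at p" and aff: "\<And>t. h (s + t *\<^sub>R u) = b * t + c"
  shows "grad h (s + t *\<^sub>R u) \<bullet> u = b"
proof -
  have frechet: "frechet_derivative h (at (s + t *\<^sub>R u)) = (\<lambda>v. grad h (s + t *\<^sub>R u) \<bullet> v)"
    by (rule ext) (rule frechet_derivative_eq_grad[OF assms(1)])
  have h': "(h has_derivative (\<lambda>v. grad h (s + t *\<^sub>R u) \<bullet> v)) (at (s + t *\<^sub>R u))"
    using assms(1)[of "s + t *\<^sub>R u"] unfolding frechet_derivative_works frechet .
  have "((\<lambda>t. s + t *\<^sub>R u) has_derivative (\<lambda>x. x *\<^sub>R u)) (at t)"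
    by (auto intro!: derivative_eq_intros)
  from has_derivative_compose[OF this h']
  have "((\<lambda>t. h (s + t *\<^sub>R u)) has_derivative (\<lambda>x. grad h (s + t *\<^sub>R u) \<bullet> (x *\<^sub>R u))) (at t)" .
  moreover have "((\<lambda>t. h (s + t *\<^sub>R u)) has_derivative (\<lambda>x. b * x)) (at t)"
    unfolding aff by (auto intro!: derivative_eq_intros)
  ultimately have "(\<lambda>x. grad h (s + t *\<^sub>R u) \<bullet> (x *\<^sub>R u)) = (\<lambda>x. b * x)"
    by (rule has_derivative_unique)
  from fun_cong[OF this, of 1] show ?thesis by simp
qed

text \<open>A bad line through the square is almost parallel to an axis.\<close>

lemma bad_line_direction:
  assumes h: "saddle_like \<epsilon> h" and l: "bad_line h l" and p: "p \<in> l" "p \<in> param_square"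
  obtains s u where "l = line_along s u" "u \<noteq> 0"
    "\<bar>fst u\<bar> * \<bar>snd u\<bar> \<le> \<epsilon> * (\<bar>fst u\<bar> + \<bar>snd u\<bar>)\<^sup>2"
proof -
  obtain s u b c where l: "l = line_along s u" "u \<noteq> 0" "\<bar>fst u\<bar> \<le> 1" "\<bar>snd u\<bar> \<le> 1"
    "\<And>t. h (s + t *\<^sub>R u) = b * t + c"
    using bad_line_affine_on[OF l] by metis
  obtain t where t: "p = s + t *\<^sub>R u" using p l(1) by (auto simp: line_along_def)
  have diff: "h differentiable at q" for q using h unfolding saddle_like_def by blast
  have "grad h p \<bullet> u = b" "grad h (p + u) \<bullet> u = b"
    using grad_along_affine_line[OF diff l(5), of t] grad_along_affine_line[OF diff l(5), of "t + 1"]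
    by (simp_all add: t algebra_simps)
  then have ortho: "(grad h (p + u) - grad h p) \<bullet> u = 0" by (simp add: inner_diff_left)
  have "p \<in> big_square" "p + u \<in> big_square"
    using p(2) l(3,4) by (auto simp: param_square_def big_square_def mem_Times_iff)
  then have near:
    "\<bar>fst (grad h (p + u) - grad h p) - snd (p + u - p)\<bar> \<le> 2 * \<epsilon> * (\<bar>fst (p + u - p)\<bar> + \<bar>snd (p + u - p)\<bar>)"
    "\<bar>snd (grad h (p + u) - grad h p) - fst (p + u - p)\<bar> \<le> 2 * \<epsilon> * (\<bar>fst (p + u - p)\<bar> + \<bar>snd (p + u - p)\<bar>)"
    using h unfolding saddle_like_def by blast+
  obtain x y where u: "u = (x, y)" by (cases u)
  obtain A B where w: "grad h (p + u) - grad h p = (A, B)" by (cases "grad h (p + u) - grad h p")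
  have AB: "\<bar>A - y\<bar> \<le> 2 * \<epsilon> * (\<bar>x\<bar> + \<bar>y\<bar>)" "\<bar>B - x\<bar> \<le> 2 * \<epsilon> * (\<bar>x\<bar> + \<bar>y\<bar>)"
    using near unfolding w add_diff_cancel_left' by (simp_all add: u)
  have "A * x + B * y = 0"
    using ortho unfolding w by (simp add: u inner_prod_def)
  then have "2 * (x * y) = - ((A - y) * x + (B - x) * y)"
    by (simp add: algebra_simps)
  then have "2 * (\<bar>x\<bar> * \<bar>y\<bar>) \<le> \<bar>A - y\<bar> * \<bar>x\<bar> + \<bar>B - x\<bar> * \<bar>y\<bar>"
    by (simp flip: abs_mult)
  also have "\<dots> \<le> 2 * \<epsilon> * (\<bar>x\<bar> + \<bar>y\<bar>) * \<bar>x\<bar> + 2 * \<epsilon> * (\<bar>x\<bar> + \<bar>y\<bar>) * \<bar>y\<bar>"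
    by (intro add_mono mult_right_mono AB) auto
  also have "\<dots> = 2 * (\<epsilon> * (\<bar>x\<bar> + \<bar>y\<bar>)\<^sup>2)" by (simp add: power2_eq_square algebra_simps)
  finally show thesis by (intro that[OF l(1,2)]) (simp add: u)
qed

text \<open>The opposite of the inequality of \<open>bad_line_direction\<close>.\<close>

lemma axis_clear_product_gt:
  assumes clear: "axis_clear \<theta> v" and s: "4 * \<epsilon> \<le> sin \<theta>" and \<epsilon>: "0 < \<epsilon>"
  shows "\<epsilon> * (\<bar>fst v\<bar> + \<bar>snd v\<bar>)\<^sup>2 < \<bar>fst v\<bar> * \<bar>snd v\<bar>"
proof -
  have main: "\<epsilon> * (x + y)\<^sup>2 < x * y"
    if "x \<le> y" "0 \<le> x" "y * sin \<theta> < x * cos \<theta>" for x y :: real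
  proof -
    have "x * cos \<theta> \<le> x" using that by (simp add: mult_left_le)
    with that have "y * sin \<theta> < x" by linarith
    moreover have "y * (4 * \<epsilon>) \<le> y * sin \<theta>" using s that by (intro mult_left_mono) auto
    ultimately have x: "y * (4 * \<epsilon>) < x" by linarith
    have y: "0 < y" using that x by (cases "y = 0") auto
    have "\<epsilon> * (x + y)\<^sup>2 \<le> \<epsilon> * (2 * y)\<^sup>2"
      using that \<epsilon> by (intro mult_left_mono power_mono) auto
    also have "\<dots> = (y * (4 * \<epsilon>)) * y" by (simp add: power2_eq_square)
    also have "\<dots> < x * y" by (rule mult_strict_right_mono[OF x y])
    finally show ?thesis .
  qed
  show ?thesis
  proof (cases "\<bar>fst v\<bar> \<le> \<bar>snd v\<bar>")
    case True
    then show ?thesis using clear by (intro main) (auto simp: axis_clear_def)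
  next
    case False
    then show ?thesis using clear main[of "\<bar>snd v\<bar>" "\<bar>fst v\<bar>"]
      by (auto simp: axis_clear_def add.commute mult.commute)
  qed
qed

section \<open>Points on a good line\<close>

lemma not_bad_point:
  assumes h: "saddle_like \<epsilon> h" and \<epsilon>: "0 < \<epsilon>"
    and s: "4 * \<epsilon> \<le> sin \<theta>" and clear: "axis_clear \<theta> (perp (grad h q - grad h p))"
  shows "\<not> bad_point h p q"
proof
  assume bad: "bad_point h p q"
  define w where "w = grad h q - grad h p"
  have w: "w \<noteq> 0" using axis_clear_nonzero[OF clear] perp_eq_0_iff unfolding w_def by blast
  have diff: "h differentiable at r" for r using h unfolding saddle_like_def by blast
  from bad consider (normal) "normal_vector h q = normal_vector h p"
    | (line) l where "bad_line h l" "q \<in> l" "q \<in> param_square"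
        "affine_parallel (graph_lift h l) (tangent_plane h p \<inter> tangent_plane h q)"
    unfolding bad_point_def by blast
  then show False
  proof cases
    case normal
    have "normal_vector h r = sgn (- grad h r, 1)" for r
      by (simp add: normal_vector_def grad_def)
    with normal have "sgn (- grad h q, 1 :: real) = sgn (- grad h p, 1)" by simp
    then have "grad h q = grad h p"
      by (auto simp: sgn_div_norm prod_eq_iff)
    with w show False by (simp add: w_def)
  next
    case line
    obtain s0 where I: "fst ` (tangent_plane h p \<inter> tangent_plane h q) = line_along s0 (perp w)"
      using tangent_planes_inter[OF diff diff] w unfolding w_def by metis
    obtain s u where u: "l = line_along s u" "u \<noteq> 0"
      "\<bar>fst u\<bar> * \<bar>snd u\<bar> \<le> \<epsilon> * (\<bar>fst u\<bar> + \<bar>snd u\<bar>)\<^sup>2"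
      using bad_line_direction[OF h line(1-3)] by metis
    obtain b where b: "tangent_plane h p \<inter> tangent_plane h q = (\<lambda>x. b + x) ` graph_lift h l"
      using line(4) by (auto simp: affine_parallel_def)
    have "line_along s0 (perp w) = (\<lambda>x. fst b + x) ` l"
      unfolding I[symmetric] b by (simp add: graph_lift_def image_image)
    then have "affine_parallel l (line_along s0 (perp w))" unfolding affine_parallel_def by blast
    then obtain s' where l: "l = line_along s' (perp w)" by (rule affine_parallel_line_along)
    have "s \<in> l" "s + u \<in> l"
      unfolding u(1) by (auto intro: mem_line_alongI[of _ _ 0] mem_line_alongI[of _ _ 1])
    then obtain c where c: "u = c *\<^sub>R perp w"
      unfolding l by (metis add_diff_cancel_left' diff_in_line_along)
    with u(2) have "c \<noteq> 0" by auto
    with clear have "axis_clear \<theta> u" by (simp add: c w_def)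
    from axis_clear_product_gt[OF this s \<epsilon>] u(3) show False by simp
  qed
qed

lemma axes_angle_gt_parallel:
  assumes "axis_clear \<theta> v" "0 \<le> \<theta>" "\<theta> < pi / 2" "affine_parallel m (line_along s v)"
  shows "axes_angle_gt \<theta> m"
proof -
  obtain s' where "m = line_along s' v" using affine_parallel_line_along[OF assms(4)] .
  moreover have "v \<noteq> 0" by (rule axis_clear_nonzero[OF assms(1)])
  ultimately show ?thesis
    unfolding axes_angle_gt_def using line_angles_gt_iff_axis_clear[OF _ assms(2,3)] assms(1) by blast
qed

lemma good_chord:
  fixes \<epsilon> :: real
  assumes h: "saddle_like \<epsilon> h" and \<epsilon>: "0 < \<epsilon>" "\<epsilon> \<le> 1 / 1600" and l: "good_line \<epsilon> l"
    and p: "p \<in> l \<inter> param_square" and q: "q \<in> l \<inter> param_square" and pq: "p \<noteq> q"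
  defines "I \<equiv> tangent_plane h p \<inter> tangent_plane h q"
  shows "\<not> bad_point h p q" and "is_line I" and "is_line (fst ` I)"
    and "affine_parallel m (fst ` I) \<Longrightarrow> axes_angle_gt (sqrt \<epsilon> - 20 * \<epsilon>) m"
    and "affine_parallel m (fst ` I) \<Longrightarrow> axes_angle_gt (sqrt \<epsilon> + 20 * \<epsilon>) l \<Longrightarrow> good_line \<epsilon> m"
proof -
  let ?w = "grad h q - grad h p"
  have rt: "0 < sqrt \<epsilon>" using \<epsilon> by simp
  have "sqrt \<epsilon> \<le> sqrt ((1 / 40)\<^sup>2)" using \<epsilon> by (intro real_sqrt_le_mono) (simp add: power2_eq_square)
  then have rt40: "sqrt \<epsilon> \<le> 1 / 40" by simp
  \<comment> \<open>The bound \<open>\<epsilon> \<le> 1/1600\<close> is chosen so that the loss \<open>20\<epsilon>\<close> is at most half of the angle \<open>sqrt \<epsilon>\<close>.\<close>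
  have "\<epsilon> = sqrt \<epsilon> * sqrt \<epsilon>" using \<epsilon> by simp
  also have "\<dots> \<le> 1 / 40 * sqrt \<epsilon>" using rt rt40 by (intro mult_right_mono) auto
  finally have half: "20 * \<epsilon> \<le> sqrt \<epsilon> / 2" by simp
  have sq: "p \<in> big_square" "q \<in> big_square" using p q param_square_subset by auto
  have pi: "3 < pi" by (rule pi_gt3)
  have clear: "axis_clear (\<theta> - 20 * \<epsilon>) (perp ?w)"
    if "axes_angle_gt \<theta> l" "20 * \<epsilon> \<le> \<theta>" "\<theta> \<le> 1" for \<theta>
  proof -
    have "axis_clear \<theta> (q - p)"
      by (rule axis_clear_chord[OF that(1)]) (use that p q pq \<epsilon> pi in auto)
    then show ?thesis
      by (intro axis_clear_perp_grad_diff[OF h \<epsilon>(1)]) (use that sq \<epsilon> pi in auto)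
  qed
  have clear1: "axis_clear (sqrt \<epsilon> - 20 * \<epsilon>) (perp ?w)"
    using l half rt rt40 by (intro clear) (auto simp: good_line_def)
  then have w: "?w \<noteq> 0" using axis_clear_nonzero perp_eq_0_iff by blast
  have "4 * \<epsilon> \<le> (sqrt \<epsilon> - 20 * \<epsilon>) / 2" using half \<epsilon>(1) by (simp add: field_simps)
  also have "\<dots> \<le> sin (sqrt \<epsilon> - 20 * \<epsilon>)"
    using half rt rt40 \<epsilon> by (intro sin_ge_half) auto
  finally show "\<not> bad_point h p q" by (rule not_bad_point[OF h \<epsilon>(1) _ clear1])
  have diff: "h differentiable at r" for r using h unfolding saddle_like_def by blast
  obtain s where I: "is_line I" "fst ` I = line_along s (perp ?w)"
    using tangent_planes_inter[OF diff diff w] unfolding I_def by metis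
  show "is_line I" by (rule I(1))
  show "is_line (fst ` I)" unfolding I(2) is_line_def using w perp_eq_0_iff by blast
  show "axes_angle_gt (sqrt \<epsilon> - 20 * \<epsilon>) m" if "affine_parallel m (fst ` I)"
    using that half rt rt40 \<epsilon> pi unfolding I(2)
    by (intro axes_angle_gt_parallel[OF clear1]) auto
  show "good_line \<epsilon> m" if "affine_parallel m (fst ` I)" "axes_angle_gt (sqrt \<epsilon> + 20 * \<epsilon>) l"
  proof -
    have "axis_clear (sqrt \<epsilon> + 20 * \<epsilon> - 20 * \<epsilon>) (perp ?w)"
      using that(2) half rt rt40 by (intro clear) auto
    then have "axis_clear (sqrt \<epsilon>) (perp ?w)" by simp
    then show ?thesis unfolding good_line_def
      using that(1) rt rt40 pi unfolding I(2) by (intro axes_angle_gt_parallel) auto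
  qed
qed

theorem corollary3p1:
  fixes D :: nat
  shows "\<exists>C>0. \<exists>\<epsilon>\<^sub>1>0. \<forall>\<epsilon>\<^sub>0 a l p\<^sub>1 p\<^sub>2.
    0 < \<epsilon>\<^sub>0 \<and> \<epsilon>\<^sub>0 \<le> \<epsilon>\<^sub>1 \<and> small_coeffs D \<epsilon>\<^sub>0 a \<and> good_line \<epsilon>\<^sub>0 l \<and>
    p\<^sub>1 \<in> l \<inter> param_square \<and> p\<^sub>2 \<in> l \<inter> param_square \<and> p\<^sub>1 \<noteq> p\<^sub>2 \<longrightarrow>
      \<not> bad_point (surf_poly D a) p\<^sub>1 p\<^sub>2 \<and> \<not> bad_point (surf_poly D a) p\<^sub>2 p\<^sub>1 \<and>
      (let I = tangent_plane (surf_poly D a) p\<^sub>1 \<inter> tangent_plane (surf_poly D a) p\<^sub>2 in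
         is_line I \<and> is_line (fst ` I) \<and>
         (\<forall>p\<in>{p\<^sub>1, p\<^sub>2}. \<forall>m. is_line m \<and> p \<in> m \<and> affine_parallel m (fst ` I) \<longrightarrow>
            axes_angle_gt (sqrt \<epsilon>\<^sub>0 - C * \<epsilon>\<^sub>0) m \<and>
            (axes_angle_gt (sqrt \<epsilon>\<^sub>0 + C * \<epsilon>\<^sub>0) l \<longrightarrow> good_line \<epsilon>\<^sub>0 m)))"
proof (rule exI[of _ 20], rule conjI, simp, rule exI[of _ "1 / 1600"], rule conjI, simp,
    intro allI impI)
  fix \<epsilon>\<^sub>0 :: real and a l and p\<^sub>1 p\<^sub>2 :: "real \<times> real"
  let ?h = "surf_poly D a"
  assume "0 < \<epsilon>\<^sub>0 \<and> \<epsilon>\<^sub>0 \<le> 1 / 1600 \<and> small_coeffs D \<epsilon>\<^sub>0 a \<and> good_line \<epsilon>\<^sub>0 l \<and>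
    p\<^sub>1 \<in> l \<inter> param_square \<and> p\<^sub>2 \<in> l \<inter> param_square \<and> p\<^sub>1 \<noteq> p\<^sub>2"
  then have \<epsilon>: "0 < \<epsilon>\<^sub>0" "\<epsilon>\<^sub>0 \<le> 1 / 1600" and h: "saddle_like \<epsilon>\<^sub>0 ?h" and l: "good_line \<epsilon>\<^sub>0 l"
    and p: "p\<^sub>1 \<in> l \<inter> param_square" "p\<^sub>2 \<in> l \<inter> param_square" "p\<^sub>1 \<noteq> p\<^sub>2"
    by (auto intro: saddle_like_surf_poly)
  note chord = good_chord[OF h \<epsilon> l p]
  have "\<not> bad_point ?h p\<^sub>2 p\<^sub>1" by (rule good_chord(1)[OF h \<epsilon> l p(2,1) p(3)[symmetric]])
  then show "\<not> bad_point ?h p\<^sub>1 p\<^sub>2 \<and> \<not> bad_point ?h p\<^sub>2 p\<^sub>1 \<and>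
      (let I = tangent_plane ?h p\<^sub>1 \<inter> tangent_plane ?h p\<^sub>2 in
         is_line I \<and> is_line (fst ` I) \<and>
         (\<forall>p\<in>{p\<^sub>1, p\<^sub>2}. \<forall>m. is_line m \<and> p \<in> m \<and> affine_parallel m (fst ` I) \<longrightarrow>
            axes_angle_gt (sqrt \<epsilon>\<^sub>0 - 20 * \<epsilon>\<^sub>0) m \<and>
            (axes_angle_gt (sqrt \<epsilon>\<^sub>0 + 20 * \<epsilon>\<^sub>0) l \<longrightarrow> good_line \<epsilon>\<^sub>0 m)))"
    unfolding Let_def using chord by simp
qed

end
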